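(* For every integer $n\ge 0$ and every choice of coefficients $\varepsilon_R\in\{-1,+1\}$ indexed by the dyadic rectangles $R\in\mathcal D^2$ with $|R|=2^{-n}$, $$\bigg\|\sum_{R\in\mathcal D^2:\,|R|=2^{-n}}\varepsilon_R h_R\bigg\|_\infty = n+1.$$
   Context: $\mathcal D$ denotes the set of dyadic intervals in $[0,1)$, i.e. intervals $[m2^{-k},(m+1)2^{-k})$ with $k\in\mathbb N_0=\{0,1,2,\dots\}$ and $m\in\{0,1,\dots,2^k-1\}$. For $I\in\mathcal D$, the ($L^\infty$-normalized) Haar function is $h_I=-\mathbf 1_{I_{left}}+\mathbf 1_{I_{right}}$, where $I_{left},I_{right}$ are the left and right (half-open) halves of $I$; so $h_I=0$ outside $I$. $\mathcal D^2$ is the set of dyadic rectangles $R=R_1\times R_2$ with $R_1,R_2\in\mathcal D$, $|R|=|R_1|\,|R_2|$ is the area, and $h_R(x_1,x_2)=h_{R_1}(x_1)h_{R_2}(x_2)$. $\|\cdot\|_\infty$ is the supremum norm on $[0,1)^2$. *)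

theory Defs
  imports "HOL-Analysis.Analysis"
begin

definition dyadic_intervals :: "real set set" where
  "dyadic_intervals =
     {{real m / 2 ^ k ..< (real m + 1) / 2 ^ k} | m k :: nat. m < 2 ^ k}"

definition left_half :: "real set \<Rightarrow> real set" where
  "left_half I = {Inf I ..< (Inf I + Sup I) / 2}"

definition right_half :: "real set \<Rightarrow> real set" where
  "right_half I = {(Inf I + Sup I) / 2 ..< Sup I}"

definition haar :: "real set \<Rightarrow> real \<Rightarrow> real" where
  "haar I x = - indicator (left_half I) x + indicator (right_half I) x"

definition dyadic_rectangles :: "(real \<times> real) set set" where
  "dyadic_rectangles = {I \<times> J | I J. I \<in> dyadic_intervals \<and> J \<in> dyadic_intervals}"

definition dyadic_rectangles_of_order :: "nat \<Rightarrow> (real \<times> real) set set" where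
  "dyadic_rectangles_of_order n = {R \<in> dyadic_rectangles. measure lborel R = 1 / 2 ^ n}"

(* The sides of a nonempty rectangle R are its two projections. *)
definition haar_rect :: "(real \<times> real) set \<Rightarrow> real \<times> real \<Rightarrow> real" where
  "haar_rect R x = haar (fst ` R) (fst x) * haar (snd ` R) (snd x)"

(* A real-valued supremum: meaningful only for f bounded on the unit square,
   as every finite linear combination of Haar functions is. *)
definition sup_norm :: "(real \<times> real \<Rightarrow> real) \<Rightarrow> real" where
  "sup_norm f = (SUP x \<in> {0..<1} \<times> {0..<1}. \<bar>f x\<bar>)"

end

theory Submission
  imports Defs
begin

text \<open>
  A point \<open>(x, y)\<close> of the unit square lies in exactly \<open>n + 1\<close> dyadic rectangles of area \<open>2\<^sup>-\<^sup>n\<close>,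
  one for each length \<open>2\<^sup>-\<^sup>k\<close> (\<open>k \<le> n\<close>) of the first side, which gives the upper bound.
  For the lower bound fix \<open>y = 0\<close>. The \<open>k\<close>-th of the \<open>n + 1\<close> nonzero terms depends only on the
  first \<open>k + 1\<close> binary digits of \<open>x\<close>, and flipping digit \<open>k + 1\<close> changes its sign. Hence the
  digits of \<open>x\<close> can be chosen one after another so that all terms have the same sign.
\<close>

definition dyadic :: "nat \<Rightarrow> nat \<Rightarrow> real set" where
  "dyadic k m = {real m / 2 ^ k ..< (real m + 1) / 2 ^ k}"

text \<open>For \<open>x\<close> in [0,1) this is the only dyadic interval of length 1/2^k that
  contains \<open>x\<close>; its index is read off from the first \<open>k\<close> binary digits of
  \<open>x\<close>.\<close>

definition dyadic_at :: "nat \<Rightarrow> real \<Rightarrow> real set" where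
  "dyadic_at k x = dyadic k (nat \<lfloor>2 ^ k * x\<rfloor>)"

lemma dyadic_intervals_eq: "dyadic_intervals = {dyadic k m | m k. m < 2 ^ k}"
  by (simp add: dyadic_intervals_def dyadic_def)

lemma dyadic_nonempty: "dyadic k m \<noteq> {}"
  by (simp add: dyadic_def field_simps)

lemma dyadic_subset_unit:
  assumes "m < 2 ^ k"
  shows "dyadic k m \<subseteq> {0..<1}"
proof -
  have "real m + 1 \<le> 2 ^ k"
    using assms by (metis Suc_leI of_nat_Suc of_nat_le_iff of_nat_numeral of_nat_power add.commute)
  then have "(real m + 1) / 2 ^ k \<le> 1" by simp
  moreover have "0 \<le> real m / 2 ^ k" by simp
  ultimately show ?thesis
    unfolding dyadic_def by (meson atLeastLessThan_subset_iff ivl_subset)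
qed

text \<open>Scaling by \<open>2 ^ k\<close> turns membership into a floor equation, so questions of
  containment and disjointness at one level become equations between indices. Since
  \<open>nat\<close> sends negative floors to 0, \<open>x\<close> has to be nonnegative.\<close>

lemma mem_dyadic_iff:
  assumes "0 \<le> x"
  shows "x \<in> dyadic k m \<longleftrightarrow> m = nat \<lfloor>2 ^ k * x\<rfloor>"
proof -
  have "x \<in> dyadic k m \<longleftrightarrow> real m \<le> 2 ^ k * x \<and> 2 ^ k * x < real m + 1"
    by (simp add: dyadic_def field_simps)
  also have "\<dots> \<longleftrightarrow> \<lfloor>2 ^ k * x\<rfloor> = int m"
    by (simp add: floor_eq_iff)
  also have "\<dots> \<longleftrightarrow> m = nat \<lfloor>2 ^ k * x\<rfloor>"
    using assms by auto
  finally show ?thesis .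
qed

lemma dyadic_at_eq:
  assumes "0 \<le> x" "x \<in> dyadic k m"
  shows "dyadic_at k x = dyadic k m"
  using assms by (simp add: dyadic_at_def mem_dyadic_iff)

lemma dyadic_index_less:
  assumes "x \<in> {0..<1}"
  shows "nat \<lfloor>2 ^ k * x\<rfloor> < 2 ^ k"
proof -
  have "2 ^ k * x < 2 ^ k" using assms by simp
  then have "\<lfloor>2 ^ k * x\<rfloor> < 2 ^ k" by (simp add: floor_less_iff)
  then show ?thesis by (simp add: nat_less_iff zless_nat_eq_int_zless)
qed

lemma measure_dyadic: "measure lborel (dyadic k m) = 1 / 2 ^ k"
  by (simp add: dyadic_def field_simps)

lemma measure_dyadic_times: "measure lborel (dyadic k a \<times> dyadic l b) = 1 / 2 ^ (k + l)"
proof -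
  have "emeasure lborel (dyadic k a \<times> dyadic l b)
      = emeasure lborel (dyadic k a) * emeasure lborel (dyadic l b)"
    unfolding lborel_prod[symmetric]
    by (rule lborel.emeasure_pair_measure_Times) (auto simp: dyadic_def)
  then have "measure lborel (dyadic k a \<times> dyadic l b)
      = measure lborel (dyadic k a) * measure lborel (dyadic l b)"
    by (simp add: measure_def enn2real_mult)
  then show ?thesis by (simp add: measure_dyadic power_add)
qed

text \<open>The halves of a dyadic interval are the dyadic intervals of the next level with indices
  \<open>2 * m\<close> and \<open>2 * m + 1\<close>. Inside the interval the Haar function thus
  reads the next binary digit of \<open>x\<close>.\<close>

lemma haar_dyadic:
  "haar (dyadic k m) x =
     (if x \<in> dyadic (Suc k) (2 * m) then -1 else if x \<in> dyadic (Suc k) (2 * m + 1) then 1 else 0)"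
proof -
  have less: "real m / 2 ^ k < (real m + 1) / 2 ^ k" by (simp add: field_simps)
  have mid: "(real m / 2 ^ k + (real m + 1) / 2 ^ k) / 2 = (2 * real m + 1) / 2 ^ Suc k"
    by (simp add: field_simps)
  have right_end: "(real m + 1) / 2 ^ k = (2 * real m + 2) / 2 ^ Suc k"
    by (simp add: field_simps)
  have "left_half (dyadic k m) = dyadic (Suc k) (2 * m)"
    unfolding left_half_def dyadic_def cInf_atLeastLessThan[OF less] cSup_atLeastLessThan[OF less] mid
    by simp
  moreover have "right_half (dyadic k m) = dyadic (Suc k) (2 * m + 1)"
    unfolding right_half_def dyadic_def cInf_atLeastLessThan[OF less] cSup_atLeastLessThan[OF less] mid
    unfolding right_end by (simp add: add.commute)
  moreover have "dyadic (Suc k) (2 * m) \<inter> dyadic (Suc k) (2 * m + 1) = {}"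
    by (auto simp: dyadic_def add.commute)
  ultimately show ?thesis by (auto simp: haar_def indicator_def)
qed

lemma dyadic_split: "dyadic k m = dyadic (Suc k) (2 * m) \<union> dyadic (Suc k) (2 * m + 1)"
  by (auto simp: dyadic_def field_simps)

lemma abs_haar_dyadic: "\<bar>haar (dyadic k m) x\<bar> = (if x \<in> dyadic k m then 1 else 0)"
  unfolding haar_dyadic by (auto simp: dyadic_split[of k m])

text \<open>The point 0 lies in the left half at every level. With second coordinate 0, the second
  Haar factor therefore never affects the relative signs of the terms.\<close>

lemma haar_dyadic_at_0: "haar (dyadic_at k 0) 0 = -1"
  by (simp add: dyadic_at_def haar_dyadic mem_dyadic_iff)

text \<open>This is the choice of digits, by induction on \<open>N\<close>. On the interval found
  for \<open>N\<close> the values at levels below \<open>N\<close> are already settled, and the sign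
  wanted at level \<open>N\<close> depends only on that interval, so passing to one of its halves
  realizes it.\<close>

lemma exists_dyadic_prescribed_haar:
  assumes "\<And>k m. k < N \<Longrightarrow> m < 2 ^ k \<Longrightarrow> \<delta> k (dyadic k m) \<in> {-1, 1}"
  shows "\<exists>m < 2 ^ N. \<forall>x \<in> dyadic N m. \<forall>k < N. haar (dyadic_at k x) x = \<delta> k (dyadic_at k x)"
  using assms
proof (induction N)
  case 0
  show ?case by (rule exI[of _ 0]) simp
next
  case (Suc N)
  then obtain m where m: "m < 2 ^ N"
    and IH: "\<And>x k. x \<in> dyadic N m \<Longrightarrow> k < N \<Longrightarrow> haar (dyadic_at k x) x = \<delta> k (dyadic_at k x)"
    by (metis less_SucI)
  \<comment> \<open>The Haar function is -1 on the left half and 1 on the right half.\<close>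
  define m' where "m' = (if \<delta> N (dyadic N m) = -1 then 2 * m else 2 * m + 1)"
  have m': "m' < 2 ^ Suc N" using m by (auto simp: m'_def)
  have "haar (dyadic_at k x) x = \<delta> k (dyadic_at k x)"
    if x: "x \<in> dyadic (Suc N) m'" and k: "k < Suc N" for x k
  proof -
    have xm: "x \<in> dyadic N m"
      using x dyadic_split[of N m] by (auto simp: m'_def split: if_splits)
    have x0: "0 \<le> x" using x dyadic_subset_unit[OF m'] by auto
    have "haar (dyadic N m) x = \<delta> N (dyadic N m)"
      using x Suc.prems[of N m] m x0
      by (auto simp: haar_dyadic m'_def mem_dyadic_iff simp del: One_nat_def split: if_splits)
    then show ?thesis
      using IH[OF xm, of k] k dyadic_at_eq[OF x0 xm] by (cases "k = N") auto
  qed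
  then show ?case using m' by blast
qed

text \<open>The area of a product of intervals of levels \<open>k\<close> and \<open>l\<close> is
  1/2^(k+l), so fixing the area forces \<open>l = n - k\<close>.\<close>

lemma dyadic_rectangles_of_order_eq:
  "dyadic_rectangles_of_order n =
     {dyadic k a \<times> dyadic (n - k) b | k a b. k \<le> n \<and> a < 2 ^ k \<and> b < 2 ^ (n - k)}"
    (is "?L = ?R")
proof
  show "?L \<subseteq> ?R"
  proof
    fix R assume "R \<in> ?L"
    then obtain k a l b where R: "R = dyadic k a \<times> dyadic l b" "a < 2 ^ k" "b < 2 ^ l"
      and "measure lborel R = 1 / 2 ^ n"
      by (auto simp: dyadic_rectangles_of_order_def dyadic_rectangles_def dyadic_intervals_eq)
    then have "(2::real) ^ (k + l) = 2 ^ n" by (simp add: measure_dyadic_times)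
    then have "k + l = n" by (rule power_inject_exp[THEN iffD1, rotated]) simp
    then have "k \<le> n" "l = n - k" by auto
    with R show "R \<in> ?R" by blast
  qed
  show "?R \<subseteq> ?L"
    by (auto simp: dyadic_rectangles_of_order_def dyadic_rectangles_def dyadic_intervals_eq
        measure_dyadic_times)
qed

lemma dyadic_times_mem:
  assumes "k \<le> n" "a < 2 ^ k" "b < 2 ^ (n - k)"
  shows "dyadic k a \<times> dyadic (n - k) b \<in> dyadic_rectangles_of_order n"
  unfolding dyadic_rectangles_of_order_eq using assms by blast

lemma finite_dyadic_rectangles_of_order: "finite (dyadic_rectangles_of_order n)"
proof (rule finite_subset)
  show "dyadic_rectangles_of_order n \<subseteq>
    (\<lambda>(k, a, b). dyadic k a \<times> dyadic (n - k) b) ` (SIGMA k:{..n}. {..<2 ^ k} \<times> {..<2 ^ (n - k)})"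
    by (force simp: dyadic_rectangles_of_order_eq)
qed auto

lemma haar_rect_dyadic:
  "haar_rect (dyadic k a \<times> dyadic l b) (x, y) = haar (dyadic k a) x * haar (dyadic l b) y"
  by (simp add: haar_rect_def dyadic_nonempty)

text \<open>The length of the first side determines \<open>k\<close>.\<close>

lemma inj_dyadic_at_times: "inj_on (\<lambda>k. dyadic_at k x \<times> dyadic_at (n - k) y) K"
proof (rule inj_onI)
  fix k l assume "dyadic_at k x \<times> dyadic_at (n - k) y = dyadic_at l x \<times> dyadic_at (n - l) y"
  then have "dyadic_at k x = dyadic_at l x"
    by (auto simp: dyadic_at_def times_eq_iff dyadic_nonempty)
  then have "(1::real) / 2 ^ k = 1 / 2 ^ l"
    unfolding dyadic_at_def by (metis measure_dyadic)
  then show "k = l" by simp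
qed

lemma dyadic_at_times_mem:
  assumes "x \<in> {0..<1}" "y \<in> {0..<1}" "k \<le> n"
  shows "dyadic_at k x \<times> dyadic_at (n - k) y \<in> dyadic_rectangles_of_order n"
  unfolding dyadic_at_def by (intro dyadic_times_mem dyadic_index_less assms)

text \<open>Only rectangles containing the point contribute, and for each \<open>k\<close> there is
  exactly one of them with first side of length 1/2^k.\<close>

lemma haar_sum_at:
  assumes "x \<in> {0..<1}" "y \<in> {0..<1}"
  shows "(\<Sum>R \<in> dyadic_rectangles_of_order n. \<epsilon> R * haar_rect R (x, y)) =
    (\<Sum>k\<le>n. \<epsilon> (dyadic_at k x \<times> dyadic_at (n - k) y)
        * (haar (dyadic_at k x) x * haar (dyadic_at (n - k) y) y))"
proof -
  let ?r = "\<lambda>k. dyadic_at k x \<times> dyadic_at (n - k) y"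
  have zero: "haar_rect R (x, y) = 0"
    if R_mem: "R \<in> dyadic_rectangles_of_order n - ?r ` {..n}" for R
  proof -
    obtain k a b where R: "R = dyadic k a \<times> dyadic (n - k) b" "k \<le> n"
      using R_mem unfolding dyadic_rectangles_of_order_eq by blast
    have "x \<notin> dyadic k a \<or> y \<notin> dyadic (n - k) b"
    proof (rule ccontr)
      assume "\<not> ?thesis"
      then have "R = ?r k"
        using R assms by (simp add: dyadic_at_eq[of x k a] dyadic_at_eq[of y "n - k" b])
      then show False using R_mem R(2) by blast
    qed
    then have "haar (dyadic k a) x = 0 \<or> haar (dyadic (n - k) b) y = 0"
      by (metis abs_haar_dyadic abs_eq_0)
    then show ?thesis by (auto simp: R haar_rect_dyadic)
  qed
  have "(\<Sum>R \<in> dyadic_rectangles_of_order n. \<epsilon> R * haar_rect R (x, y))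
      = (\<Sum>R \<in> ?r ` {..n}. \<epsilon> R * haar_rect R (x, y))"
    using assms zero dyadic_at_times_mem
    by (intro sum.mono_neutral_right finite_dyadic_rectangles_of_order) auto
  also have "\<dots> = (\<Sum>k\<le>n. \<epsilon> (?r k) * haar_rect (?r k) (x, y))"
    by (simp add: sum.reindex[OF inj_dyadic_at_times])
  finally show ?thesis by (simp add: dyadic_at_def haar_rect_dyadic)
qed

theorem theorem5:
  fixes n :: nat and \<epsilon> :: "(real \<times> real) set \<Rightarrow> real"
  assumes "\<And>R. R \<in> dyadic_rectangles_of_order n \<Longrightarrow> \<epsilon> R \<in> {-1, 1}"
  shows "sup_norm (\<lambda>x. \<Sum>R \<in> dyadic_rectangles_of_order n. \<epsilon> R * haar_rect R x) = real n + 1"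
proof -
  let ?f = "\<lambda>x. \<Sum>R \<in> dyadic_rectangles_of_order n. \<epsilon> R * haar_rect R x"
  let ?r = "\<lambda>x y k. dyadic_at k x \<times> dyadic_at (n - k) y"
  have upper: "\<bar>?f (x, y)\<bar> \<le> real n + 1" if xy: "x \<in> {0..<1}" "y \<in> {0..<1}" for x y
  proof -
    have "\<bar>\<epsilon> (?r x y k) * (haar (dyadic_at k x) x * haar (dyadic_at (n - k) y) y)\<bar> \<le> 1"
      if "k \<le> n" for k
      using assms[OF dyadic_at_times_mem[OF xy that]]
      by (auto simp: abs_mult dyadic_at_def abs_haar_dyadic)
    then have "\<bar>?f (x, y)\<bar> \<le> (\<Sum>k\<le>n. 1)"
      unfolding haar_sum_at[OF xy] by (intro order.trans[OF sum_abs] sum_mono) auto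
    then show ?thesis by simp
  qed
  \<comment> \<open>With second coordinate 0 the second side is a function of \<open>k\<close>
    alone, so the coefficient becomes a sign depending on the level and the first side. There are
    \<open>Suc n\<close> levels to prescribe, from 0 to \<open>n\<close>.\<close>
  have "\<epsilon> (dyadic k m \<times> dyadic_at (n - k) 0) \<in> {-1, 1}" if "k < Suc n" "m < 2 ^ k" for k m
    using that by (intro assms) (simp add: dyadic_at_def dyadic_times_mem)
  then have "\<exists>m < 2 ^ Suc n. \<forall>x \<in> dyadic (Suc n) m. \<forall>k < Suc n.
      haar (dyadic_at k x) x = \<epsilon> (dyadic_at k x \<times> dyadic_at (n - k) 0)"
    by (rule exists_dyadic_prescribed_haar[of "Suc n" "\<lambda>k I. \<epsilon> (I \<times> dyadic_at (n - k) 0)"])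
  then obtain m where m: "m < 2 ^ Suc n"
    and haar_eq: "\<forall>x \<in> dyadic (Suc n) m. \<forall>k < Suc n.
      haar (dyadic_at k x) x = \<epsilon> (dyadic_at k x \<times> dyadic_at (n - k) 0)"
    by blast
  obtain x where x: "x \<in> dyadic (Suc n) m" using dyadic_nonempty by blast
  then have x01: "x \<in> {0..<1}" using dyadic_subset_unit[OF m] by blast
  \<comment> \<open>The factor in \<open>x\<close> equals the coefficient, so their product is a
    square of a sign, hence 1; the factor at 0 contributes -1.\<close>
  have "\<epsilon> (?r x 0 k) * (haar (dyadic_at k x) x * haar (dyadic_at (n - k) 0) 0) = -1"
    if "k \<le> n" for k
  proof -
    have "haar (dyadic_at k x) x = \<epsilon> (?r x 0 k)"
      using haar_eq x that by (simp add: less_Suc_eq_le)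
    moreover have "\<epsilon> (?r x 0 k) \<in> {-1, 1}"
      using x01 that by (intro assms dyadic_at_times_mem) auto
    ultimately show ?thesis by (auto simp: haar_dyadic_at_0)
  qed
  then have "?f (x, 0) = (\<Sum>k\<le>n. -1)"
    using x01 by (simp add: haar_sum_at)
  then have attained: "\<bar>?f (x, 0)\<bar> = real n + 1" by simp
  show ?thesis
    unfolding sup_norm_def
  \<comment> \<open>The upper bound is attained at \<open>(x, 0)\<close>, so the supremum is a
    maximum.\<close>
  proof (rule cSup_eq_maximum)
    show "real n + 1 \<in> (\<lambda>x. \<bar>?f x\<bar>) ` ({0..<1} \<times> {0..<1})"
      using attained x01 by (intro image_eqI[of _ _ "(x, 0)"]) auto
  qed (use upper in auto)
qed

end
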